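(* Let $F:\mathbb{R}^n\times\mathbb{R}^m\to\mathbb{R}^m$ be path differentiable with conservative Jacobian $J_F$. Let $(\hat x,\hat y)\in\mathbb{R}^n\times\mathbb{R}^m$ be such that $F(\hat x,\hat y)=0$. Assume that $J_F(\hat x,\hat y)$ is convex and that, for each $[A\ B]\in J_F(\hat x,\hat y)$ (with $A\in\mathbb{R}^{m\times n}$, $B\in\mathbb{R}^{m\times m}$), the matrix $B$ is invertible. Then there exist an open neighborhood $\mathcal{U}\times\mathcal{V}\subset\mathbb{R}^n\times\mathbb{R}^m$ of $(\hat x,\hat y)$ and a path differentiable function $G:\mathcal{U}\to\mathcal{V}$ such that, for all $x\in\mathcal{U}$, $F(x,G(x))=0$, every $[A\ B]\in J_F(x,G(x))$ has $B$ invertible, and the set-valued map $$J_G: x\rightrightarrows\left\{-B^{-1}A \;:\; [A\ B]\in J_F(x,G(x))\right\}$$ is a conservative Jacobian for $G$ on $\mathcal{U}$.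
   Context: Conservative Jacobian: let $\mathcal{O}\subset\mathbb{R}^p$ be open and $H:\mathcal{O}\to\mathbb{R}^q$ locally Lipschitz. A set-valued map $J_H:\mathcal{O}\rightrightarrows\mathbb{R}^{q\times p}$ is a conservative Jacobian for $H$ (on $\mathcal{O}$) if it has nonempty values, has a closed graph, is locally bounded, and for every absolutely continuous curve $\gamma:[0,1]\to\mathcal{O}$ one has, for almost every $t\in[0,1]$, $\frac{d}{dt}H(\gamma(t))=M\dot\gamma(t)$ for all $M\in J_H(\gamma(t))$. A locally Lipschitz function is path differentiable (on $\mathcal{O}$) if it has a conservative Jacobian (on $\mathcal{O}$). $[A\ B]$ denotes columnwise concatenation of matrices. *)

theory Defs
  imports "HOL-Analysis.Analysis"
begin

definition locally_lipschitz_on :: "'a::metric_space set \<Rightarrow> ('a \<Rightarrow> 'b::metric_space) \<Rightarrow> bool" where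
  "locally_lipschitz_on S H \<longleftrightarrow> (\<forall>x\<in>S. \<exists>u>0. \<exists>L. L-lipschitz_on (ball x u \<inter> S) H)"

(* Absolute continuity of curves; the library's absolutely_continuous is about measures. *)
definition abs_continuous_on_interval :: "real \<Rightarrow> real \<Rightarrow> (real \<Rightarrow> 'a::metric_space) \<Rightarrow> bool" where
  "abs_continuous_on_interval a b \<gamma> \<longleftrightarrow>
     (\<forall>e>0. \<exists>d>0. \<forall>(N::nat) (l::nat \<Rightarrow> real) (u::nat \<Rightarrow> real).
        (\<forall>i<N. a \<le> l i \<and> l i \<le> u i \<and> u i \<le> b) \<longrightarrow>
        disjoint_family_on (\<lambda>i. {l i<..<u i}) {..<N} \<longrightarrow>
        (\<Sum>i<N. u i - l i) < d \<longrightarrow>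
        (\<Sum>i<N. dist (\<gamma> (l i)) (\<gamma> (u i))) < e)"

(* Only the values of H and J on S matter; the graph is closed relative to S x R^(q x p).
   That both derivatives exist at almost every t is part of the chain rule. *)
definition conservative_jacobian ::
    "(real^'p) set \<Rightarrow> (real^'p \<Rightarrow> real^'q) \<Rightarrow> (real^'p \<Rightarrow> (real^'p^'q) set) \<Rightarrow> bool" where
  "conservative_jacobian S H J \<longleftrightarrow>
     open S \<and> locally_lipschitz_on S H \<and>
     (\<forall>x\<in>S. J x \<noteq> {}) \<and>
     closedin (top_of_set (S \<times> UNIV)) {(x, M). x \<in> S \<and> M \<in> J x} \<and>
     (\<forall>x\<in>S. \<exists>u>0. bounded (\<Union>z\<in>ball x u \<inter> S. J z)) \<and>
     (\<forall>\<gamma>. abs_continuous_on_interval 0 1 \<gamma> \<and> \<gamma> ` {0..1} \<subseteq> S \<longrightarrow>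
        (AE t in lebesgue_on {0..1}. \<exists>v.
           (\<gamma> has_vector_derivative v) (at t within {0..1}) \<and>
           (\<forall>M\<in>J (\<gamma> t).
              ((\<lambda>s. H (\<gamma> s)) has_vector_derivative M *v v) (at t within {0..1}))))"

definition path_differentiable_on :: "(real^'p) set \<Rightarrow> (real^'p \<Rightarrow> real^'q) \<Rightarrow> bool" where
  "path_differentiable_on S H \<longleftrightarrow>
     locally_lipschitz_on S H \<and> (\<exists>J. conservative_jacobian S H J)"

(* R^n x R^m is identified with R^(n+m), indexed by the sum type 'n + 'm:
   vconcat x y is the point (x, y), and mconcat A B is the matrix [A B]. *)
definition vconcat :: "'a^'n \<Rightarrow> 'a^'m \<Rightarrow> 'a^('n + 'm)" where
  "vconcat x y = (\<chi> k. case k of Inl i \<Rightarrow> x $ i | Inr j \<Rightarrow> y $ j)"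

definition mconcat :: "'a^'n^'r \<Rightarrow> 'a^'m^'r \<Rightarrow> 'a^('n + 'm)^'r" where
  "mconcat A B = (\<chi> i. vconcat (A $ i) (B $ i))"

end

theory Submission
  imports Defs
begin

text \<open>
  Let \<open>K\<close> be a small closed neighbourhood of the compact convex set \<open>J\<^sub>F(xh, yh)\<close>. By upper
  semicontinuity \<open>J\<^sub>F\<close> takes its values in \<open>K\<close> near \<open>(xh, yh)\<close>, and the right blocks of the elements of \<open>K\<close>
  are invertible with a uniform bound. The chain rule along a segment says that
  the derivative of \<open>F\<close> along it lies almost everywhere in \<open>K (z' - z)\<close>; as this set is closed and convex,
  \<open>F z' - F z = M (z' - z)\<close> for some \<open>M \<in> K\<close>. This mean value formula replaces the Clarke Jacobian.
  It makes \<open>F (x, \<cdot>)\<close> injective with a lower Lipschitz bound, so \<open>F (x, \<cdot>)\<close> is open by invariance of domain,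
  and a minimiser of \<open>norm (F (x, \<cdot>))\<close> on a ball must be a zero \<open>G x\<close>. The same formula gives that \<open>G\<close> is Lipschitz.
  Finally, differentiating \<open>F (\<gamma>, G \<circ> \<gamma>) = 0\<close> by the chain rule of \<open>F\<close> yields that of \<open>G\<close>.
\<close>

section \<open>Lipschitz functions with constrained derivative\<close>

text \<open>The set of \<open>t\<close> with \<open>f a \<le> f t\<close> is compact, so it has a
  greatest element. If that element were smaller than \<open>b\<close>, \<open>right\<close> would
  supply a larger one.\<close>

lemma locally_right_increasing_imp_le:
  fixes f :: "real \<Rightarrow> real"
  assumes "a \<le> b" and cont: "continuous_on {a..b} f"
    and right: "\<And>t. a \<le> t \<Longrightarrow> t < b \<Longrightarrow> \<exists>s. t < s \<and> s \<le> b \<and> f t \<le> f s"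
  shows "f a \<le> f b"
proof -
  define S where "S = {t \<in> {a..b}. f a \<le> f t}"
  have "compact S"
  proof -
    have "closed S"
      unfolding S_def by (intro continuous_on_closed_Collect_le cont continuous_on_const) auto
    moreover have "bounded S"
      by (rule bounded_subset[of "{a..b}"]) (auto simp: S_def)
    ultimately show ?thesis
      by (simp add: compact_eq_bounded_closed)
  qed
  moreover have "a \<in> S"
    using \<open>a \<le> b\<close> by (simp add: S_def)
  ultimately obtain t where t: "t \<in> S" "\<And>s. s \<in> S \<Longrightarrow> s \<le> t"
    using compact_attains_sup[of S] by auto
  have "t = b"
  proof (rule ccontr)
    assume "t \<noteq> b"
    with t(1) have "a \<le> t" "t < b"
      by (auto simp: S_def)
    then obtain s where "t < s" "s \<le> b" "f t \<le> f s"
      using right by blast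
    then have "s \<in> S"
      using t(1) by (auto simp: S_def)
    with t(2) \<open>t < s\<close> show False
      by fastforce
  qed
  with t(1) show ?thesis
    by (simp add: S_def)
qed

text \<open>
  Adding to \<open>f\<close> the function \<open>t \<mapsto> L |T \<inter> [a,t]|\<close>, where \<open>T\<close> is a small open cover of the exceptional
  set, compensates the possible decrease of \<open>f\<close> on that set.
\<close>

lemma lipschitz_ae_deriv_nonneg_imp_le:
  fixes f :: "real \<Rightarrow> real"
  assumes "a \<le> b" and lip: "L-lipschitz_on {a..b} f" and N: "negligible N"
    and deriv: "\<And>t. t \<in> {a..b} - N \<Longrightarrow>
      \<exists>d\<ge>0. (f has_real_derivative d) (at t within {a..b})"
  shows "f a \<le> f b"
proof -
  have L: "L \<ge> 0"
    using lip by (rule lipschitz_on_nonneg)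
  have "f a \<le> f b + e" if "e > 0" for e
  proof -
    \<comment> \<open>The losses below amount to \<open>L * k\<close>, from the measure of the
      cover, and \<open>k * (b - a)\<close>, from the linear term of \<open>g\<close>; this
      \<open>k\<close> keeps their sum below \<open>e\<close>. The \<open>1\<close> keeps the
      denominator positive.\<close>
    define k where "k = e / (L + (b - a) + 1)"
    have k: "k > 0"
      using \<open>e > 0\<close> L \<open>a \<le> b\<close> by (simp add: k_def)
    obtain T where T: "open T" "N \<subseteq> T" "T - N \<in> lmeasurable"
        "emeasure lebesgue (T - N) < ennreal k"
      using sets_lebesgue_outer_open[OF negligible_imp_sets[OF N] k] by blast
    have Tm: "T \<in> lmeasurable"
    proof -
      have "T = (T - N) \<union> N" using T by blast
      moreover have "N \<in> lmeasurable" using N by (simp add: negligible_imp_measurable)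
      ultimately show ?thesis using T(3) by (metis fmeasurable.Un)
    qed
    have Tk: "measure lebesgue T < k"
    proof -
      have "measure lebesgue T = measure lebesgue (T - N)"
        using N T(3) by (metis Tm measure_Diff_null_set negligible_iff_null_sets fmeasurableD)
      also have "\<dots> < k"
        using T(3,4) k by (simp add: emeasure_eq_measure2 fmeasurableD2 ennreal_less_iff)
      finally show ?thesis .
    qed
    define h where "h t = measure lebesgue (T \<inter> {a..t})" for t
    have Tcap: "T \<inter> {p..q} \<in> lmeasurable" "T \<inter> {p<..q} \<in> lmeasurable" for p q
      using Tm by (auto intro: fmeasurable_Int_fmeasurable)
    have h_diff: "h q - h p = measure lebesgue (T \<inter> {p<..q})" if "a \<le> p" "p \<le> q" for p q
    proof -
      have "T \<inter> {a..q} = (T \<inter> {a..p}) \<union> (T \<inter> {p<..q})" using that by auto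
      moreover have "(T \<inter> {p<..q}) - (T \<inter> {a..p}) = T \<inter> {p<..q}" by auto
      ultimately show ?thesis
        unfolding h_def using measure_Un2[OF Tcap(1)[of a p] Tcap(2)[of p q]] by simp
    qed
    have h_mono: "h p \<le> h q" if "a \<le> p" "p \<le> q" for p q
      using h_diff[OF that] by (metis diff_ge_0_iff_ge measure_nonneg)
    have h_lip: "h q - h p \<le> q - p" if "a \<le> p" "p \<le> q" for p q
    proof -
      have "measure lebesgue (T \<inter> {p<..q}) \<le> measure lebesgue {p<..q}"
        using Tcap by (intro measure_mono_fmeasurable) (use that in \<open>auto simp: fmeasurable_def\<close>)
      then show ?thesis using h_diff[OF that] that by simp
    qed
    have h_cont: "continuous_on {a..b} h"
    proof -
      have "1-lipschitz_on {a..b} h"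
      proof (rule lipschitz_onI)
        fix p q assume "p \<in> {a..b}" "q \<in> {a..b}"
        then show "dist (h p) (h q) \<le> 1 * dist p q"
          using h_mono[of p q] h_mono[of q p] h_lip[of p q] h_lip[of q p]
          by (auto simp: dist_real_def abs_if)
      qed simp
      then show ?thesis by (rule lipschitz_on_continuous_on)
    qed
    \<comment> \<open>The term \<open>L * h t\<close> pays for a decrease of \<open>f\<close> on
      \<open>T\<close>; the term \<open>k * (t - a)\<close> pays for difference quotients that are
      slightly negative although their limit is nonnegative.\<close>
    define g where "g t = f t + L * h t + k * (t - a)" for t
    have "g a \<le> g b"
    proof (rule locally_right_increasing_imp_le[OF \<open>a \<le> b\<close>])
      show "continuous_on {a..b} g"
        unfolding g_def
        by (intro continuous_intros h_cont lipschitz_on_continuous_on[OF lip])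
      fix t assume t: "a \<le> t" "t < b"
      show "\<exists>s. t < s \<and> s \<le> b \<and> g t \<le> g s"
      proof (cases "t \<in> T")
        case True
        then obtain d where d: "d > 0" "cball t d \<subseteq> T"
          using T(1) open_contains_cball by metis
        \<comment> \<open>An interval to the right of \<open>t\<close> lies in \<open>T\<close>,
          where \<open>h\<close> has slope 1, so \<open>L * h\<close> offsets a decrease of
          \<open>f\<close> at rate \<open>L\<close>, the fastest possible.\<close>
        define s where "s = min b (t + d)"
        have s: "t < s" "s \<le> b" "{t<..s} \<subseteq> T"
          using t d by (auto simp: s_def subset_eq dist_real_def)
        have "h s - h t = s - t"
          using h_diff[of t s] s t by (simp add: Int_absorb1)
        moreover have "\<bar>f s - f t\<bar> \<le> L * (s - t)"
          using lipschitz_onD[OF lip, of s t] s t by (simp add: dist_real_def)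
        ultimately have "f t + L * h t \<le> f s + L * h s"
          by (smt (verit, ccfv_SIG) right_diff_distrib)
        moreover have "k * (t - a) \<le> k * (s - a)"
          using k s by (intro mult_left_mono) auto
        ultimately show ?thesis using s unfolding g_def by fastforce
      next
        case False
        \<comment> \<open>\<open>T\<close> covers \<open>N\<close>, so \<open>t\<close> is a point
          where the derivative exists and is nonnegative.\<close>
        then obtain D where D: "D \<ge> 0" "(f has_real_derivative D) (at t within {a..b})"
          using deriv[of t] T(2) t by auto
        then have "((\<lambda>s. (f s - f t) / (s - t)) \<longlongrightarrow> D) (at t within {a..b})"
          by (simp add: has_field_derivative_iff)
        then have "\<forall>\<^sub>F s in at t within {a..b}. (f s - f t) / (s - t) > - k"
          by (rule order_tendstoD) (use D k in simp)
        then obtain d where d: "d > 0"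
            "\<And>s. s \<in> {a..b} \<Longrightarrow> s \<noteq> t \<Longrightarrow> dist s t < d \<Longrightarrow> (f s - f t) / (s - t) > - k"
          unfolding eventually_at by blast
        define s where "s = min b (t + d / 2)"
        have s: "t < s" "s \<le> b" "dist s t < d"
          using t d(1) by (auto simp: s_def dist_real_def)
        then have "(f s - f t) / (s - t) > - k"
          using d(2)[of s] t by auto
        then have "f s - f t \<ge> - k * (s - t)"
          using s(1) by (simp add: pos_less_divide_eq)
        moreover have "L * h t \<le> L * h s"
          using h_mono[of t s] s t L by (intro mult_left_mono) auto
        ultimately have "g t \<le> g s"
          unfolding g_def by (simp add: algebra_simps)
        then show ?thesis using s by blast
      qed
    qed
    moreover have "L * h a \<ge> 0" using L by (simp add: h_def)
    moreover have "h b \<le> k"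
    proof -
      have "h b \<le> measure lebesgue T"
        unfolding h_def using Tm Tcap by (intro measure_mono_fmeasurable) auto
      then show ?thesis using Tk by simp
    qed
    ultimately have "f a \<le> f b + L * k + k * (b - a)"
      using mult_left_mono[of "h b" k L] L unfolding g_def diff_self mult_zero_right by linarith
    also have "\<dots> \<le> f b + k * (L + (b - a) + 1)"
      using k by (simp add: algebra_simps)
    also have "\<dots> = f b + e"
      using L \<open>a \<le> b\<close> by (simp add: k_def)
    finally show ?thesis .
  qed
  then show ?thesis
    by (rule field_le_epsilon)
qed

text \<open>Otherwise a hyperplane strictly separates \<open>f 1 - f 0\<close> from
  \<open>C\<close>. With \<open>a\<close> and \<open>b\<close> from that separation, the scalar
  function \<open>a \<bullet> f t - b * t\<close> has positive derivative almost everywhere, so its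
  value at 1 is at least that at 0, which contradicts the separation.\<close>

lemma lipschitz_ae_deriv_in_convex_imp_increment_in:
  fixes f :: "real \<Rightarrow> 'a::euclidean_space"
  assumes lip: "L-lipschitz_on {0..1} f" and C: "convex C" "closed C"
    and ae: "AE t in lebesgue_on {0..1}. \<exists>d\<in>C. (f has_vector_derivative d) (at t within {0..1})"
  shows "f 1 - f 0 \<in> C"
proof (rule ccontr)
  assume "f 1 - f 0 \<notin> C"
  then obtain a b where ab: "a \<bullet> (f 1 - f 0) < b" "\<And>x. x \<in> C \<Longrightarrow> a \<bullet> x > b"
    using separating_hyperplane_closed_point[OF C] by blast
  have "AE t in lebesgue. t \<in> {0..1::real} \<longrightarrow>
      (\<exists>d\<in>C. (f has_vector_derivative d) (at t within {0..1}))"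
    using ae by (subst (asm) AE_restrict_space_iff) auto
  then obtain N where N: "N \<in> null_sets lebesgue"
    "{t. \<not> (t \<in> {0..1::real} \<longrightarrow>
      (\<exists>d\<in>C. (f has_vector_derivative d) (at t within {0..1})))} \<subseteq> N"
    unfolding eventually_ae_filter by auto
  define g where "g t = a \<bullet> f t - b * t" for t
  have "(norm a * L + \<bar>b\<bar>)-lipschitz_on {0..1} g"
  proof (rule lipschitz_onI)
    fix s t :: real assume st: "s \<in> {0..1}" "t \<in> {0..1}"
    have "\<bar>g s - g t\<bar> = \<bar>a \<bullet> (f s - f t) - b * (s - t)\<bar>"
      by (simp add: g_def algebra_simps)
    also have "\<dots> \<le> \<bar>a \<bullet> (f s - f t)\<bar> + \<bar>b\<bar> * \<bar>s - t\<bar>"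
      by (metis abs_mult abs_triangle_ineq4)
    also have "\<bar>a \<bullet> (f s - f t)\<bar> \<le> norm a * (L * \<bar>s - t\<bar>)"
      using lipschitz_onD[OF lip st]
      by (intro order_trans[OF Cauchy_Schwarz_ineq2] mult_left_mono) (auto simp: dist_norm)
    finally show "dist (g s) (g t) \<le> (norm a * L + \<bar>b\<bar>) * dist s t"
      by (simp add: dist_real_def algebra_simps)
  qed (use lipschitz_on_nonneg[OF lip] in simp)
  moreover have "negligible N"
    using N(1) by (simp only: negligible_iff_null_sets)
  moreover have "\<exists>D\<ge>0. (g has_real_derivative D) (at t within {0..1})" if t: "t \<in> {0..1} - N" for t
  proof -
    obtain d where d: "d \<in> C" "(f has_vector_derivative d) (at t within {0..1})"
      using N(2) t by blast
    have "(g has_vector_derivative (a \<bullet> d - b)) (at t within {0..1})"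
      unfolding g_def
      by (rule has_vector_derivative_diff
          [OF bounded_linear.has_vector_derivative[OF bounded_linear_inner_right d(2)]])
         (auto intro!: derivative_eq_intros
           simp flip: has_real_derivative_iff_has_vector_derivative)
    then show ?thesis
      using ab(2)[OF d(1)] less_imp_le[of b "a \<bullet> d"] unfolding has_real_derivative_iff_has_vector_derivative
      by (intro exI[of _ "a \<bullet> d - b"]) simp
  qed
  ultimately have "g 0 \<le> g 1"
    by (intro lipschitz_ae_deriv_nonneg_imp_le[OF zero_le_one])
  then show False
    using ab(1) by (simp add: g_def inner_diff_right)
qed

section \<open>Matrices and block decompositions\<close>

text \<open>The norm of a matrix is here the Euclidean norm of its entries, so Cauchy-Schwarz in
  each row suffices.\<close>

lemma norm_matrix_vector_mult_le:
  fixes M :: "real^'k^'m"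
  shows "norm (M *v x) \<le> norm M * norm x"
proof -
  have "norm (M *v x) = L2_set (\<lambda>i. \<bar>M $ i \<bullet> x\<bar>) UNIV"
    by (simp add: norm_vec_def matrix_vector_mul_component)
  also have "\<dots> \<le> L2_set (\<lambda>i. norm (M $ i) * norm x) UNIV"
    by (intro L2_set_mono) (auto simp: Cauchy_Schwarz_ineq2)
  also have "\<dots> = norm M * norm x"
    by (simp add: norm_vec_def[of M] L2_set_left_distrib)
  finally show ?thesis .
qed

lemma bounded_bilinear_matrix_vector_mult:
  "bounded_bilinear ((*v) :: real^'k^'m \<Rightarrow> real^'k \<Rightarrow> real^'m)"
proof (rule bounded_bilinear.intro)
  show "\<exists>K. \<forall>a b. norm ((a :: real^'k^'m) *v b) \<le> norm a * norm b * K"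
    using norm_matrix_vector_mult_le by (metis mult.right_neutral)
qed (auto simp: algebra_simps vec_eq_iff matrix_vector_mult_def sum.distrib sum_distrib_left)

lemmas tendsto_matrix_vector_mult =
  bounded_bilinear.tendsto[OF bounded_bilinear_matrix_vector_mult]

lemmas continuous_on_matrix_vector_mult =
  bounded_bilinear.continuous_on[OF bounded_bilinear_matrix_vector_mult]

text \<open>Entry \<open>(i, j)\<close> is a component of \<open>N *v axis j 1\<close>, hence at
  most \<open>b\<close> in absolute value. The bound converts operator estimates into boundedness of
  sets of matrices, as local boundedness asks.\<close>

lemma norm_matrix_le_of_operator_bound:
  fixes N :: "real^'k^'m"
  assumes "\<And>w. norm (N *v w) \<le> b * norm w"
  shows "norm N \<le> real CARD('m) * (real CARD('k) * b)"
proof -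
  have entry: "\<bar>N $ i $ j\<bar> \<le> b" for i j
  proof -
    have "\<bar>(N *v axis j 1) $ i\<bar> \<le> norm (N *v axis j 1)"
      by (rule component_le_norm_cart)
    also have "\<dots> \<le> b * norm (axis j (1::real) :: real^'k)"
      by (rule assms)
    finally show ?thesis
      by (simp add: matrix_vector_mult_basis column_def)
  qed
  have "norm N \<le> (\<Sum>i\<in>UNIV. norm (N $ i))"
    by (simp add: norm_vec_def L2_set_le_sum)
  also have "\<dots> \<le> (\<Sum>i\<in>(UNIV::'m set). \<Sum>j\<in>(UNIV::'k set). b)"
    by (intro sum_mono order_trans[OF norm_le_l1_cart]) (rule entry)
  finally show ?thesis by simp
qed

lemma invertible_iff_ker:
  fixes B :: "real^'m^'m"
  shows "invertible B \<longleftrightarrow> (\<forall>v. B *v v = 0 \<longrightarrow> v = 0)"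
  by (simp add: invertible_left_inverse matrix_left_invertible_ker)

section \<open>Vectors and matrices in blocks\<close>

lemma sum_UNIV_Plus:
  fixes f :: "'a::finite + 'b::finite \<Rightarrow> 'c::comm_monoid_add"
  shows "sum f UNIV = (\<Sum>i\<in>UNIV. f (Inl i)) + (\<Sum>j\<in>UNIV. f (Inr j))"
  using sum.Plus[of UNIV UNIV f] by (simp add: o_def)

lemma vconcat_nth [simp]: "vconcat x y $ Inl i = x $ i" "vconcat x y $ Inr j = y $ j"
  by (simp_all add: vconcat_def)

lemma vconcat_cases: obtains x y where "z = vconcat x y"
proof
  show "z = vconcat (\<chi> i. z $ Inl i) (\<chi> j. z $ Inr j)"
    by (auto simp: vec_eq_iff vconcat_def split: sum.split)
qed

lemma mconcat_cases: obtains A B where "M = mconcat A B"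
proof
  show "M = mconcat (\<chi> i j. M $ i $ Inl j) (\<chi> i j. M $ i $ Inr j)"
    by (auto simp: vec_eq_iff mconcat_def vconcat_def split: sum.split)
qed

lemma vconcat_diff: "vconcat x y - vconcat x' y' = vconcat (x - x') (y - y')"
  by (auto simp: vec_eq_iff vconcat_def split: sum.split)

lemma mconcat_mult_vconcat:
  fixes A :: "real^'n^'r" and B :: "real^'m^'r"
  shows "mconcat A B *v vconcat x y = A *v x + B *v y"
  by (simp add: vec_eq_iff matrix_vector_mult_def mconcat_def sum_UNIV_Plus)

lemma linear_vconcat: "linear (\<lambda>z. vconcat (fst z) (snd z) :: real^('n::finite + 'm::finite))"
  by (rule linearI) (auto simp: vec_eq_iff vconcat_def split: sum.split)

lemma norm_vconcat_power2:
  fixes x :: "real^'n" and y :: "real^'m"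
  shows "norm (vconcat x y) ^ 2 = norm x ^ 2 + norm y ^ 2"
  by (simp add: norm_vec_def L2_set_def sum_nonneg sum_UNIV_Plus)

lemma norm_vconcat_le:
  fixes x :: "real^'n" and y :: "real^'m"
  shows "norm (vconcat x y) \<le> norm x + norm y"
  by (rule power2_le_imp_le) (auto simp: norm_vconcat_power2 power2_sum)

lemma norm_vconcat_zero [simp]:
  fixes x :: "real^'n" and y :: "real^'m"
  shows "norm (vconcat 0 y :: real^('n + 'm)) = norm y" "norm (vconcat x 0 :: real^('n + 'm)) = norm x"
  using norm_vconcat_power2[of 0 y] norm_vconcat_power2[of x 0] by simp_all

lemma tendsto_vconcat:
  fixes f :: "'a \<Rightarrow> real^'n" and g :: "'a \<Rightarrow> real^'m"
  assumes "(f \<longlongrightarrow> x) F" "(g \<longlongrightarrow> y) F"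
  shows "((\<lambda>t. vconcat (f t) (g t)) \<longlongrightarrow> vconcat x y) F"
  using bounded_linear.tendsto[OF linear_linear[THEN iffD2, OF linear_vconcat] tendsto_Pair[OF assms]]
  by simp

lemma continuous_on_vconcat:
  fixes f :: "'a::topological_space \<Rightarrow> real^'n" and g :: "'a \<Rightarrow> real^'m"
  assumes "continuous_on S f" "continuous_on S g"
  shows "continuous_on S (\<lambda>t. vconcat (f t) (g t))"
  using assms by (auto simp: continuous_on_def intro: tendsto_vconcat)

lemma has_vector_derivative_vconcatD:
  fixes f :: "real \<Rightarrow> real^'n" and g :: "real \<Rightarrow> real^'m"
  assumes "((\<lambda>t. vconcat (f t) (g t)) has_vector_derivative vconcat v w) F"
  shows "(f has_vector_derivative v) F" "(g has_vector_derivative w) F"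
proof -
  have "linear (\<lambda>z::real^('n + 'm). \<chi> i. z $ Inl i)" "linear (\<lambda>z::real^('n + 'm). \<chi> i. z $ Inr i)"
    by (auto intro!: linearI simp: vec_eq_iff)
  then show "(f has_vector_derivative v) F" "(g has_vector_derivative w) F"
    using bounded_linear.has_vector_derivative[OF _ assms] by (force simp: linear_linear)+
qed

section \<open>Absolutely continuous curves and conservative Jacobians\<close>

lemma closedin_top_of_set_sequentially:
  fixes S :: "'a::metric_space set"
  shows "closedin (top_of_set T) S \<longleftrightarrow>
    S \<subseteq> T \<and> (\<forall>f l. (\<forall>n. f n \<in> S) \<and> l \<in> T \<and> f \<longlonglongrightarrow> l \<longrightarrow> l \<in> S)"
proof
  assume "closedin (top_of_set T) S"
  then obtain C where "closed C" "S = T \<inter> C"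
    by (auto simp: closedin_closed)
  then show "S \<subseteq> T \<and> (\<forall>f l. (\<forall>n. f n \<in> S) \<and> l \<in> T \<and> f \<longlonglongrightarrow> l \<longrightarrow> l \<in> S)"
    by (auto simp: closed_sequential_limits)
next
  assume *: "S \<subseteq> T \<and> (\<forall>f l. (\<forall>n. f n \<in> S) \<and> l \<in> T \<and> f \<longlonglongrightarrow> l \<longrightarrow> l \<in> S)"
  show "closedin (top_of_set T) S"
    unfolding closedin_limpt islimpt_sequential using * by blast
qed

text \<open>The map enlarges the sums over subintervals by a factor of at most \<open>L\<close>.
  This is applied both to the identity of an interval and to the lift of a curve to the graph of the
  implicit function.\<close>

lemma abs_continuous_on_interval_lipschitz_comp:
  assumes ac: "abs_continuous_on_interval a b \<gamma>" and sub: "\<gamma> ` {a..b} \<subseteq> S"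
    and lip: "L-lipschitz_on S f"
  shows "abs_continuous_on_interval a b (\<lambda>t. f (\<gamma> t))"
  unfolding abs_continuous_on_interval_def
proof (intro allI impI)
  fix e :: real assume "e > 0"
  have L: "L \<ge> 0" using lip by (rule lipschitz_on_nonneg)
  \<comment> \<open>Division by \<open>L + 1\<close> instead of \<open>L\<close> covers the case
    \<open>L = 0\<close>.\<close>
  then have "e / (L + 1) > 0" using \<open>e > 0\<close> by simp
  then obtain d where d: "d > 0"
    "\<And>(N::nat) l u. (\<forall>i<N. a \<le> l i \<and> l i \<le> u i \<and> u i \<le> b) \<Longrightarrow>
        disjoint_family_on (\<lambda>i. {l i<..<u i}) {..<N} \<Longrightarrow>
        (\<Sum>i<N. u i - l i) < d \<Longrightarrow> (\<Sum>i<N. dist (\<gamma> (l i)) (\<gamma> (u i))) < e / (L + 1)"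
    using ac unfolding abs_continuous_on_interval_def by meson
  show "\<exists>d>0. \<forall>(N::nat) l u. (\<forall>i<N. a \<le> l i \<and> l i \<le> u i \<and> u i \<le> b) \<longrightarrow>
        disjoint_family_on (\<lambda>i. {l i<..<u i}) {..<N} \<longrightarrow>
        (\<Sum>i<N. u i - l i) < d \<longrightarrow> (\<Sum>i<N. dist (f (\<gamma> (l i))) (f (\<gamma> (u i)))) < e"
  proof (intro exI[of _ d] conjI allI impI)
    fix N :: nat and l u
    assume *: "\<forall>i<N. a \<le> l i \<and> l i \<le> u i \<and> u i \<le> b"
      "disjoint_family_on (\<lambda>i. {l i<..<u i}) {..<N}" "(\<Sum>i<N. u i - l i) < d"
    have "(\<Sum>i<N. dist (f (\<gamma> (l i))) (f (\<gamma> (u i)))) \<le> (\<Sum>i<N. L * dist (\<gamma> (l i)) (\<gamma> (u i)))"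
      using *(1) sub by (intro sum_mono lipschitz_onD[OF lip]) force+
    also have "\<dots> \<le> (L + 1) * (\<Sum>i<N. dist (\<gamma> (l i)) (\<gamma> (u i)))"
      unfolding sum_distrib_left[symmetric] by (intro mult_right_mono sum_nonneg) auto
    also have "\<dots> < (L + 1) * (e / (L + 1))"
      using d(2)[OF *] L by (intro mult_strict_left_mono) auto
    finally show "(\<Sum>i<N. dist (f (\<gamma> (l i))) (f (\<gamma> (u i)))) < e"
      using L by simp
  qed (fact d(1))
qed

text \<open>The function is its own composition with the identity, which is absolutely continuous
  with \<open>d = e\<close>.\<close>

lemma lipschitz_imp_abs_continuous_on_interval:
  assumes "L-lipschitz_on {a..b} f"
  shows "abs_continuous_on_interval a b f"
proof -
  have "abs_continuous_on_interval a b (\<lambda>t::real. t)"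
    unfolding abs_continuous_on_interval_def
  proof (intro allI impI)
    fix e :: real assume "e > 0"
    moreover have "(\<Sum>i<N. dist (l i) (u i)) = (\<Sum>i<N. u i - l i)"
      if "\<forall>i<N. a \<le> l i \<and> l i \<le> u i \<and> u i \<le> b" for N :: nat and l u :: "nat \<Rightarrow> real"
      using that by (intro sum.cong) (auto simp: dist_real_def)
    ultimately show "\<exists>d>0. \<forall>(N::nat) l u. (\<forall>i<N. a \<le> l i \<and> l i \<le> u i \<and> u i \<le> b) \<longrightarrow>
        disjoint_family_on (\<lambda>i. {l i<..<u i}) {..<N} \<longrightarrow>
        (\<Sum>i<N. u i - l i) < d \<longrightarrow> (\<Sum>i<N. dist (l i) (u i)) < e"
      by (intro exI[of _ e]) simp
  qed
  from abs_continuous_on_interval_lipschitz_comp[OF this _ assms] show ?thesis by simp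
qed

text \<open>The velocity of the segment is the constant \<open>z' - z\<close>, so the chain rule
  puts almost every derivative of \<open>F\<close> along it into the image of \<open>K\<close> under
  \<open>M \<mapsto> M *v (z' - z)\<close>. This image is closed and convex, so the whole increment
  lies in it. One set \<open>K\<close> stands in for the values of \<open>J\<close>, which vary
  along the segment and may fail to be convex.\<close>

lemma conservative_jacobian_mean_value:
  fixes F :: "real^'p \<Rightarrow> real^'q"
  assumes J: "conservative_jacobian S F J" and seg: "closed_segment z z' \<subseteq> S"
    and lip: "L-lipschitz_on (closed_segment z z') F"
    and K: "compact K" "convex K" and JK: "\<And>w. w \<in> closed_segment z z' \<Longrightarrow> J w \<subseteq> K"
  shows "\<exists>M\<in>K. F z' - F z = M *v (z' - z)"
proof -
  define \<gamma> where "\<gamma> t = z + t *\<^sub>R (z' - z)" for t :: real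
  have mem: "\<gamma> t \<in> closed_segment z z'" if "t \<in> {0..1}" for t
    unfolding \<gamma>_def closed_segment_def using that
    by (intro CollectI exI[of _ t]) (simp add: algebra_simps)
  have lip_\<gamma>: "(norm (z' - z))-lipschitz_on {0..1} \<gamma>"
  proof (rule lipschitz_onI)
    fix s t :: real
    have "\<gamma> s - \<gamma> t = (s - t) *\<^sub>R (z' - z)"
      by (simp add: \<gamma>_def algebra_simps)
    then show "dist (\<gamma> s) (\<gamma> t) \<le> norm (z' - z) * dist s t"
      by (simp add: dist_norm)
  qed simp
  have "L-lipschitz_on (\<gamma> ` {0..1}) F"
    using mem by (intro lipschitz_on_subset[OF lip]) auto
  then have lip_F\<gamma>: "(L * norm (z' - z))-lipschitz_on {0..1} (\<lambda>t. F (\<gamma> t))"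
    by (rule lipschitz_on_compose2[OF lip_\<gamma>])
  have der: "(\<gamma> has_vector_derivative (z' - z)) (at t within {0..1})" for t
    unfolding \<gamma>_def by (auto intro!: derivative_eq_intros)
  have "AE t in lebesgue_on {0..1}. \<exists>v.
         (\<gamma> has_vector_derivative v) (at t within {0..1}) \<and>
         (\<forall>M\<in>J (\<gamma> t). ((\<lambda>s. F (\<gamma> s)) has_vector_derivative M *v v) (at t within {0..1}))"
  proof -
    have "abs_continuous_on_interval 0 1 \<gamma>"
      by (rule lipschitz_imp_abs_continuous_on_interval[OF lip_\<gamma>])
    moreover have "\<gamma> ` {0..1} \<subseteq> S"
      using mem seg by auto
    ultimately show ?thesis
      using J by (simp add: conservative_jacobian_def)
  qed
  then have ae: "AE t in lebesgue_on {0..1}. \<exists>d\<in>(\<lambda>M. M *v (z' - z)) ` K.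
      ((\<lambda>s. F (\<gamma> s)) has_vector_derivative d) (at t within {0..1})"
  proof (rule AE_mp, intro AE_I2 impI)
    fix t assume "t \<in> space (lebesgue_on {0..1::real})"
    then have t: "t \<in> {0..1}" by simp
    assume "\<exists>v. (\<gamma> has_vector_derivative v) (at t within {0..1}) \<and>
         (\<forall>M\<in>J (\<gamma> t). ((\<lambda>s. F (\<gamma> s)) has_vector_derivative M *v v) (at t within {0..1}))"
    then obtain v where v: "(\<gamma> has_vector_derivative v) (at t within {0..1})"
      "\<And>M. M \<in> J (\<gamma> t) \<Longrightarrow> ((\<lambda>s. F (\<gamma> s)) has_vector_derivative M *v v) (at t within {0..1})"
      by blast
    \<comment> \<open>The chain rule only asserts that some derivative exists; uniqueness of
      derivatives within \<open>{0..1}\<close>, endpoints included, identifies it.\<close>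
    have "v = z' - z"
      using vector_derivative_unique_within_closed_interval[of 0 1 t \<gamma>] v(1) der t by auto
    moreover obtain M where "M \<in> J (\<gamma> t)"
      using J mem[OF t] seg unfolding conservative_jacobian_def by blast
    ultimately show "\<exists>d\<in>(\<lambda>M. M *v (z' - z)) ` K.
        ((\<lambda>s. F (\<gamma> s)) has_vector_derivative d) (at t within {0..1})"
      using v(2) JK[OF mem[OF t]] by blast
  qed
  have "compact ((\<lambda>M. M *v (z' - z)) ` K)"
    by (intro compact_continuous_image K continuous_on_matrix_vector_mult continuous_intros)
  moreover have "convex ((\<lambda>M. M *v (z' - z)) ` K)"
    by (intro convex_linear_image K bounded_linear.linear
        bounded_bilinear.bounded_linear_left[OF bounded_bilinear_matrix_vector_mult])
  ultimately have "F (\<gamma> 1) - F (\<gamma> 0) \<in> (\<lambda>M. M *v (z' - z)) ` K"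
    by (intro lipschitz_ae_deriv_in_convex_imp_increment_in[OF lip_F\<gamma> _ _ ae] compact_imp_closed)
  then show ?thesis
    by (auto simp: \<gamma>_def)
qed

section \<open>Compactness and upper semicontinuity of conservative Jacobians\<close>

lemma conservative_jacobian_limit:
  assumes "conservative_jacobian S F J" "z \<longlonglongrightarrow> l" "M \<longlonglongrightarrow> m" "l \<in> S"
    and "\<And>n::nat. z n \<in> S" "\<And>n. M n \<in> J (z n)"
  shows "m \<in> J l"
proof -
  have "closedin (top_of_set (S \<times> UNIV)) {(x, M). x \<in> S \<and> M \<in> J x}"
    using assms(1) by (simp add: conservative_jacobian_def)
  moreover have "(\<lambda>n. (z n, M n)) \<longlonglongrightarrow> (l, m)"
    by (intro tendsto_Pair assms)
  ultimately have "(l, m) \<in> {(x, M). x \<in> S \<and> M \<in> J x}"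
    using assms(4-6) unfolding closedin_top_of_set_sequentially
    by (metis (mono_tags, lifting) UNIV_I case_prodI mem_Collect_eq mem_Sigma_iff)
  then show ?thesis by simp
qed

text \<open>Local boundedness confines the tail of \<open>M\<close> to a bounded set,
  Bolzano-Weierstrass yields a convergent subsequence, and the closed graph puts its limit into
  \<open>J l\<close>. Compactness of values, upper semicontinuity and the closed graph of the
  Jacobian of \<open>G\<close> all rest on this.\<close>

lemma conservative_jacobian_convergent_subseq:
  fixes J :: "real^'p \<Rightarrow> (real^'p^'q) set"
  assumes J: "conservative_jacobian S F J" and "z \<longlonglongrightarrow> l" "l \<in> S"
    and zS: "\<And>n::nat. z n \<in> S" and zJ: "\<And>n. M n \<in> J (z n)"
  obtains m r where "m \<in> J l" "strict_mono (r :: nat \<Rightarrow> nat)" "(M \<circ> r) \<longlonglongrightarrow> m"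
proof -
  obtain u where u: "u > 0" "bounded (\<Union>w\<in>ball l u \<inter> S. J w)"
    using J \<open>l \<in> S\<close> unfolding conservative_jacobian_def by blast
  have "\<forall>\<^sub>F n in sequentially. dist (z n) l < u"
    using \<open>z \<longlonglongrightarrow> l\<close> u(1) by (rule tendstoD)
  then obtain N where N: "\<And>n. n \<ge> N \<Longrightarrow> dist (z n) l < u"
    by (auto simp: eventually_sequentially)
  have "range (\<lambda>n. M (n + N)) \<subseteq> (\<Union>w\<in>ball l u \<inter> S. J w)"
    using N zS zJ by (force simp: dist_commute)
  then have "bounded (range (\<lambda>n. M (n + N)))"
    using u(2) bounded_subset by blast
  then obtain m r where r: "strict_mono (r :: nat \<Rightarrow> nat)" "((\<lambda>n. M (n + N)) \<circ> r) \<longlonglongrightarrow> m"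
    using bounded_imp_convergent_subsequence by blast
  \<comment> \<open>Only the indices from \<open>N\<close> on are controlled; adding
    \<open>N\<close> turns a subsequence of the shifted sequence into one of
    \<open>M\<close>.\<close>
  define r' where "r' n = r n + N" for n
  have r': "strict_mono r'" "(M \<circ> r') \<longlonglongrightarrow> m"
    using r by (auto simp: r'_def strict_mono_def o_def)
  moreover have "m \<in> J l"
    using LIMSEQ_subseq_LIMSEQ[OF \<open>z \<longlonglongrightarrow> l\<close> r'(1)] r'(2) zS zJ \<open>l \<in> S\<close>
    by (intro conservative_jacobian_limit[OF J, of "z \<circ> r'" l "M \<circ> r'"]) auto
  ultimately show ?thesis using that by blast
qed

text \<open>This is the case of a constant sequence of base points in the preceding lemma.\<close>

lemma conservative_jacobian_compact_values:
  fixes J :: "real^'p \<Rightarrow> (real^'p^'q) set"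
  assumes J: "conservative_jacobian S F J" and "l \<in> S"
  shows "compact (J l)"
  unfolding compact_def
proof (intro allI impI)
  fix M :: "nat \<Rightarrow> real^'p^'q" assume "\<forall>n. M n \<in> J l"
  then show "\<exists>m\<in>J l. \<exists>r. strict_mono (r::nat \<Rightarrow> nat) \<and> (M \<circ> r) \<longlonglongrightarrow> m"
    using conservative_jacobian_convergent_subseq[OF J tendsto_const \<open>l \<in> S\<close>, of M] \<open>l \<in> S\<close> by metis
qed

text \<open>If this failed, points converging to \<open>l\<close> would carry matrices at distance
  at least \<open>e\<close> from \<open>J l\<close>, yet a subsequence of these matrices would
  converge to an element of \<open>J l\<close>.\<close>

lemma conservative_jacobian_upper_semicontinuous:
  fixes J :: "real^'p \<Rightarrow> (real^'p^'q) set"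
  assumes J: "conservative_jacobian S F J" and l: "l \<in> S" and "e > 0"
  shows "\<exists>d>0. \<forall>z\<in>ball l d \<inter> S. \<forall>M\<in>J z. \<exists>m\<in>J l. dist M m < e"
proof (rule ccontr)
  assume "\<not> ?thesis"
  then have "\<exists>z M. z \<in> ball l (inverse (Suc n)) \<inter> S \<and> M \<in> J z \<and> (\<forall>m\<in>J l. \<not> dist M m < e)" for n
    by (metis inverse_positive_iff_positive of_nat_0_less_iff zero_less_Suc)
  then obtain z M where zM: "\<And>n. z n \<in> ball l (inverse (Suc n)) \<inter> S" "\<And>n. M n \<in> J (z n)"
      "\<And>n m. m \<in> J l \<Longrightarrow> \<not> dist (M n) m < e"
    by metis
  have "z \<longlonglongrightarrow> l"
  proof (rule metric_LIMSEQ_I)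
    fix r :: real assume "r > 0"
    then obtain N where N: "inverse (Suc N) < r"
      using reals_Archimedean by blast
    have "dist (z n) l < r" if "n \<ge> N" for n
    proof -
      have "dist (z n) l < inverse (Suc n)"
        using zM(1)[of n] by (simp add: dist_commute)
      also have "\<dots> \<le> inverse (Suc N)"
        using that by (simp add: divide_simps)
      finally show ?thesis using N by linarith
    qed
    then show "\<exists>N. \<forall>n\<ge>N. dist (z n) l < r" by blast
  qed
  then obtain m r where "m \<in> J l" "(M \<circ> r) \<longlonglongrightarrow> m"
    by (rule conservative_jacobian_convergent_subseq[OF J _ l _ zM(2)]) (use zM(1) in blast)
  then have "\<forall>\<^sub>F n in sequentially. dist (M (r n)) m < e"
    using tendstoD \<open>e > 0\<close> by fastforce
  then show False
    using zM(3)[OF \<open>m \<in> J l\<close>] by (simp add: eventually_sequentially)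
qed

section \<open>The implicit function\<close>

text \<open>\<open>F\<close> is seen only through the mean value formula with matrices from
  \<open>K\<close>. The bound \<open>upper\<close> makes it \<open>C\<close>-Lipschitz;
  \<open>lower\<close> concerns the right block, since \<open>M *v vconcat 0 v\<close> sees nothing
  else, and makes \<open>F\<close> expand distances in \<open>y\<close> by at least the factor
  \<open>c\<close>. The zero comes from minimising, the constant \<open>C / c\<close> from comparing
  two zeros.\<close>

lemma lipschitz_implicit_function:
  fixes F :: "real^('n::finite + 'm::finite) \<Rightarrow> real^'m"
    and xh :: "real^'n" and yh :: "real^'m"
  assumes "r > 0" "c > 0" "C > 0" and zero: "F (vconcat xh yh) = 0"
    and cont: "continuous_on (ball (vconcat xh yh) r) F"
    and mv: "\<And>z z'. z \<in> ball (vconcat xh yh) r \<Longrightarrow> z' \<in> ball (vconcat xh yh) r \<Longrightarrow>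
      \<exists>M\<in>K. F z' - F z = M *v (z' - z)"
    and upper: "\<And>M. M \<in> K \<Longrightarrow> norm M \<le> C"
    and lower: "\<And>M (v::real^'m). M \<in> K \<Longrightarrow> c * norm v \<le> norm (M *v vconcat 0 v)"
  obtains s \<rho> G where "s > 0" "\<rho> > 0" "G ` ball xh s \<subseteq> ball yh \<rho>" "(C / c)-lipschitz_on (ball xh s) G"
    "\<And>x. x \<in> ball xh s \<Longrightarrow> F (vconcat x (G x)) = 0"
    "\<And>x. x \<in> ball xh s \<Longrightarrow> vconcat x (G x) \<in> ball (vconcat xh yh) r"
proof -
  \<comment> \<open>Moving \<open>x\<close> and \<open>y\<close> by at most \<open>r / 3\<close>
    each stays inside the ball of radius \<open>r\<close>. The second bound in \<open>s\<close>
    keeps the minimiser below off the boundary of \<open>ball yh \<rho>\<close>.\<close>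
  define \<rho> where "\<rho> = r / 3"
  define s where "s = min \<rho> (c * \<rho> / (2 * C))"
  have pos: "\<rho> > 0" "s > 0"
    using assms(1-3) by (auto simp: \<rho>_def s_def)
  have mem: "vconcat x y \<in> ball (vconcat xh yh) r" if "x \<in> ball xh s" "y \<in> cball yh \<rho>" for x y
  proof -
    have "norm (vconcat xh yh - vconcat x y) \<le> norm (xh - x) + norm (yh - y)"
      by (simp add: vconcat_diff norm_vconcat_le)
    also have "\<dots> < r"
      using that pos by (auto simp: dist_norm s_def \<rho>_def)
    finally show ?thesis by (simp add: dist_norm)
  qed
  have upper_mv: "norm (F z' - F z) \<le> C * norm (z' - z)"
    if z: "z \<in> ball (vconcat xh yh) r" "z' \<in> ball (vconcat xh yh) r" for z z'
  proof -
    obtain M where "M \<in> K" "F z' - F z = M *v (z' - z)" using mv[OF z] by blast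
    then show ?thesis
      using norm_matrix_vector_mult_le[of M "z' - z"] mult_right_mono[OF upper, of M "norm (z' - z)"]
      by simp
  qed
  have lower_mv: "c * norm (y' - y) \<le> norm (F (vconcat x y') - F (vconcat x y))"
    if x: "x \<in> ball xh s" and y: "y \<in> cball yh \<rho>" "y' \<in> cball yh \<rho>" for x y y'
  proof -
    obtain M where "M \<in> K" "F (vconcat x y') - F (vconcat x y) = M *v (vconcat x y' - vconcat x y)"
      using mv mem[OF x y(1)] mem[OF x y(2)] by blast
    then show ?thesis using lower by (simp add: vconcat_diff)
  qed
  have ex: "\<exists>y\<in>ball yh \<rho>. F (vconcat x y) = 0" if x: "x \<in> ball xh s" for x
  proof -
    have cont_x: "continuous_on (cball yh \<rho>) (\<lambda>y. F (vconcat x y))"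
      using mem[OF x]
      by (intro continuous_on_compose2[OF cont] continuous_on_vconcat continuous_intros) auto
    then obtain y where y: "y \<in> cball yh \<rho>"
        "\<And>y'. y' \<in> cball yh \<rho> \<Longrightarrow> norm (F (vconcat x y)) \<le> norm (F (vconcat x y'))"
      using continuous_attains_inf[OF compact_cball _ continuous_on_norm[OF cont_x]] pos
      by (auto simp: not_less)
    have small: "norm (F (vconcat x yh)) \<le> C * norm (x - xh)"
      using upper_mv[OF mem mem, of xh yh x yh] x pos zero by (simp add: vconcat_diff)
    \<comment> \<open>The minimal value is at most the value at \<open>yh\<close>, which is small
      for \<open>x\<close> near \<open>xh\<close>; so \<open>lower_mv\<close> forces the minimiser
      into the open ball, where invariance of domain applies.\<close>
    have "c * norm (y - yh) \<le> norm (F (vconcat x y)) + norm (F (vconcat x yh))"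
      using lower_mv[OF x _ y(1), of yh] pos by (auto intro: order_trans norm_triangle_ineq4)
    also have "\<dots> \<le> 2 * C * norm (x - xh)"
      using y(2)[of yh] small pos by simp
    also have "\<dots> < 2 * C * s"
      using x \<open>C > 0\<close> by (simp add: dist_norm norm_minus_commute)
    also have "\<dots> \<le> c * \<rho>"
      using \<open>C > 0\<close> by (simp add: s_def min_def field_simps)
    finally have y_ball: "y \<in> ball yh \<rho>"
      using \<open>c > 0\<close> by (simp add: dist_norm norm_minus_commute)
    \<comment> \<open>The image of the open ball is open, so with a nonzero value at
      \<open>y\<close> it also contains a slightly shortened multiple of that value, against
      minimality.\<close>
    have "F (vconcat x y) = 0"
    proof (rule ccontr)
      assume w: "F (vconcat x y) \<noteq> 0"
      have "inj_on (\<lambda>y. F (vconcat x y)) (ball yh \<rho>)"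
      proof (rule inj_onI)
        fix y1 y2 assume "y1 \<in> ball yh \<rho>" "y2 \<in> ball yh \<rho>" "F (vconcat x y1) = F (vconcat x y2)"
        then show "y1 = y2"
          using lower_mv[OF x, of y1 y2] \<open>c > 0\<close> by (simp add: mult_le_0_iff)
      qed
      then have "open ((\<lambda>y. F (vconcat x y)) ` ball yh \<rho>)"
        by (intro invariance_of_domain continuous_on_subset[OF cont_x]) auto
      then obtain e where e: "e > 0" "ball (F (vconcat x y)) e \<subseteq> (\<lambda>y. F (vconcat x y)) ` ball yh \<rho>"
        using y_ball by (metis imageI open_contains_ball)
      \<comment> \<open>The factor 2 keeps the shortened vector strictly within distance
        \<open>e\<close>; the cap at 1 keeps \<open>1 - t\<close> nonnegative, so that it can be
        pulled out of the norm.\<close>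
      define t where "t = min 1 (e / (2 * norm (F (vconcat x y))))"
      have t: "0 < t" "t \<le> 1" "t * norm (F (vconcat x y)) < e"
        using e(1) w by (auto simp: t_def min_def field_simps)
      have "(1 - t) *\<^sub>R F (vconcat x y) \<in> ball (F (vconcat x y)) e"
        using t by (simp add: dist_norm algebra_simps)
      then obtain y' where y': "y' \<in> ball yh \<rho>" "F (vconcat x y') = (1 - t) *\<^sub>R F (vconcat x y)"
        using e(2) by (metis (no_types, lifting) image_iff subsetD)
      then have "norm (F (vconcat x y)) \<le> (1 - t) * norm (F (vconcat x y))"
        using y(2)[of y'] t by simp
      then show False using t w by (simp add: algebra_simps mult_le_0_iff)
    qed
    with y_ball show ?thesis by blast
  qed
  then obtain G where G: "\<And>x. x \<in> ball xh s \<Longrightarrow> G x \<in> ball yh \<rho>"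
      "\<And>x. x \<in> ball xh s \<Longrightarrow> F (vconcat x (G x)) = 0"
    by metis
  have G_mem: "G x \<in> cball yh \<rho>" if "x \<in> ball xh s" for x
    using G(1)[OF that] by simp
  have "(C / c)-lipschitz_on (ball xh s) G"
  proof (rule lipschitz_onI)
    fix x x' assume x: "x \<in> ball xh s" "x' \<in> ball xh s"
    \<comment> \<open>Both points of the graph are zeros of \<open>F\<close>, so
      \<open>F (vconcat x (G x))\<close> may be replaced by \<open>F (vconcat x' (G x'))\<close>,
      which turns a change in \<open>y\<close> into a change in \<open>x\<close> alone.\<close>
    have "c * norm (G x' - G x) \<le> norm (F (vconcat x (G x')) - F (vconcat x (G x)))"
      by (intro lower_mv G_mem x)
    also have "\<dots> = norm (F (vconcat x (G x')) - F (vconcat x' (G x')))"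
      using G(2) x by simp
    also have "\<dots> \<le> C * norm (vconcat x (G x') - vconcat x' (G x'))"
      by (intro upper_mv mem G_mem x)
    also have "\<dots> = C * norm (x - x')"
      by (simp add: vconcat_diff)
    finally show "dist (G x) (G x') \<le> C / c * dist x x'"
      using \<open>c > 0\<close> by (simp add: dist_norm norm_minus_commute field_simps)
  qed (use assms in simp)
  then show ?thesis
    using that[of s \<rho> G] pos G mem G_mem by blast
qed

section \<open>The conservative Jacobian of the implicit function\<close>

lemma matrix_inv_inverse:
  fixes B :: "'a::semiring_1^'m^'n"
  assumes "invertible B"
  shows "B ** matrix_inv B = mat 1" "matrix_inv B ** B = mat 1"
  using someI_ex[OF assms[unfolded invertible_def]] unfolding matrix_inv_def by auto

text \<open>The formula for the Jacobian of \<open>G\<close> is exchanged for a linear equation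
  without inverses, which passes to limits and compares directly with the derivative of
  \<open>F\<close> along a curve.\<close>

lemma eq_neg_matrix_inv_mult_iff:
  fixes A :: "real^'n^'m" and B :: "real^'m^'m"
  assumes "invertible B"
  shows "N = - (matrix_inv B ** A) \<longleftrightarrow> (\<forall>w. mconcat A B *v vconcat w (N *v w) = 0)"
proof -
  have "matrix_inv B *v (B *v v) = v" "B *v (matrix_inv B *v v) = v" for v
    by (simp_all add: matrix_inv_inverse[OF assms] matrix_vector_mul_assoc)
  then have "u = - (matrix_inv B *v v) \<longleftrightarrow> v + B *v u = 0" for u v
    using matrix_vector_mult_diff_distrib[of B 0] matrix_vector_mult_diff_distrib[of "matrix_inv B" 0]
    by (metis add_eq_0_iff diff_0 matrix_vector_mult_0_right minus_minus)
  moreover have "(- C) *v w = - (C *v w)" for C :: "real^'n^'m" and w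
    using matrix_vector_mult_diff_rdistrib[of 0 C w] by simp
  ultimately show ?thesis
    by (simp add: matrix_eq mconcat_mult_vconcat flip: matrix_vector_mul_assoc)
qed

text \<open>By \<open>JG\<close>, an element \<open>N\<close> of the new Jacobian is one whose graph
  is annihilated by some \<open>M\<close> in the old one. This relation passes to limits, which
  gives the closed graph; with \<open>upper\<close> and \<open>lower\<close> it bounds
  \<open>N\<close>; along a curve it is compared with the derivative of the vanishing function
  \<open>F (vconcat x (G x))\<close>.\<close>

lemma conservative_jacobian_implicit:
  fixes F :: "real^('n::finite + 'm::finite) \<Rightarrow> real^'m" and G :: "real^'n \<Rightarrow> real^'m"
  assumes J: "conservative_jacobian UNIV F JF" and "open U" and lip: "L-lipschitz_on U G"
    and zero: "\<And>x. x \<in> U \<Longrightarrow> F (vconcat x (G x)) = 0" and "c > 0"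
    and upper: "\<And>x M. x \<in> U \<Longrightarrow> M \<in> JF (vconcat x (G x)) \<Longrightarrow> norm M \<le> C"
    and lower: "\<And>x M (v::real^'m). x \<in> U \<Longrightarrow> M \<in> JF (vconcat x (G x)) \<Longrightarrow>
      c * norm v \<le> norm (M *v vconcat 0 v)"
    and nonempty: "\<And>x. x \<in> U \<Longrightarrow> JG x \<noteq> {}"
    and JG: "\<And>x N. x \<in> U \<Longrightarrow> N \<in> JG x \<longleftrightarrow>
      (\<exists>M\<in>JF (vconcat x (G x)). \<forall>w. M *v vconcat w (N *v w) = 0)"
  shows "conservative_jacobian U G JG"
  unfolding conservative_jacobian_def
proof (intro conjI ballI allI impI)
  show "locally_lipschitz_on U G"
    unfolding locally_lipschitz_on_def
    by (intro ballI exI[of _ 1] conjI exI[of _ L] lipschitz_on_subset[OF lip]) auto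
  show "closedin (top_of_set (U \<times> UNIV)) {(x, M). x \<in> U \<and> M \<in> JG x}"
    unfolding closedin_top_of_set_sequentially
  proof (intro conjI allI impI)
    fix f :: "nat \<Rightarrow> (real^'n) \<times> (real^'n^'m)" and l
    assume f: "(\<forall>n. f n \<in> {(x, M). x \<in> U \<and> M \<in> JG x}) \<and> l \<in> U \<times> UNIV \<and> f \<longlonglongrightarrow> l"
    define X where "X n = fst (f n)" for n
    define N where "N n = snd (f n)" for n
    have XU: "X n \<in> U" and NJ: "N n \<in> JG (X n)" for n
      using f by (auto simp: X_def N_def split_beta)
    have lU: "fst l \<in> U" and Xl: "X \<longlonglongrightarrow> fst l" and Nl: "N \<longlonglongrightarrow> snd l"
      using f unfolding X_def N_def by (auto intro: tendsto_fst tendsto_snd)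
    \<comment> \<open>Each \<open>N n\<close> comes with its own \<open>M n\<close>. These need not
      converge, but a subsequence does because \<open>JF\<close> is locally bounded.\<close>
    obtain M where M: "\<And>n. M n \<in> JF (vconcat (X n) (G (X n)))"
      "\<And>n w. M n *v vconcat w (N n *v w) = 0"
      using NJ unfolding JG[OF XU] by metis
    have "(\<lambda>n. G (X n)) \<longlonglongrightarrow> G (fst l)"
      using lipschitz_on_continuous_on[OF lip] XU lU Xl
      by (intro continuous_on_tendsto_compose[of U G]) auto
    then have "(\<lambda>n. vconcat (X n) (G (X n))) \<longlonglongrightarrow> vconcat (fst l) (G (fst l))"
      by (intro tendsto_vconcat Xl)
    then obtain m r where m: "m \<in> JF (vconcat (fst l) (G (fst l)))" "strict_mono (r :: nat \<Rightarrow> nat)"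
        "(M \<circ> r) \<longlonglongrightarrow> m"
      by (rule conservative_jacobian_convergent_subseq[OF J _ _ _ M(1)]) auto
    have "m *v vconcat w (snd l *v w) = 0" for w
    proof (rule LIMSEQ_unique)
      show "(\<lambda>n. (M \<circ> r) n *v vconcat w ((N \<circ> r) n *v w)) \<longlonglongrightarrow> m *v vconcat w (snd l *v w)"
        by (intro tendsto_matrix_vector_mult tendsto_vconcat tendsto_const m
            LIMSEQ_subseq_LIMSEQ[OF Nl])
      show "(\<lambda>n. (M \<circ> r) n *v vconcat w ((N \<circ> r) n *v w)) \<longlonglongrightarrow> 0"
        by (simp add: M(2))
    qed
    with m(1) lU have "snd l \<in> JG (fst l)"
      using JG by blast
    with lU show "l \<in> {(x, M). x \<in> U \<and> M \<in> JG x}"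
      by (simp add: split_beta)
  qed auto
  show "\<exists>u>0. bounded (\<Union>z\<in>ball x u \<inter> U. JG z)" if "x \<in> U" for x
  proof (intro exI[of _ 1] conjI boundedI)
    fix N assume "N \<in> (\<Union>z\<in>ball x 1 \<inter> U. JG z)"
    then obtain z M where z: "z \<in> U" and M: "M \<in> JF (vconcat z (G z))"
        "\<And>w. M *v vconcat w (N *v w) = 0"
      using JG by blast
    show "norm N \<le> real CARD('m) * (real CARD('n) * (C / c))"
    proof (rule norm_matrix_le_of_operator_bound)
      fix w
      \<comment> \<open>Splitting off the block of \<open>w\<close> isolates \<open>N *v w\<close>
        in the right block, where \<open>lower\<close> applies.\<close>
      have "vconcat w (N *v w) = vconcat 0 (N *v w) - vconcat (- w) (0 :: real^'m)"
        by (simp add: vconcat_diff)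
      then have "M *v vconcat 0 (N *v w) = M *v vconcat (- w) 0"
        using M(2)[of w] by (simp add: matrix_vector_mult_diff_distrib)
      then have "c * norm (N *v w) \<le> norm (M *v vconcat (- w) 0)"
        using lower[OF z M(1)] by metis
      also have "\<dots> \<le> norm M * norm w"
        using norm_matrix_vector_mult_le[of M "vconcat (- w) 0"] by simp
      also have "\<dots> \<le> C * norm w"
        by (intro mult_right_mono upper[OF z M(1)]) simp
      finally show "norm (N *v w) \<le> C / c * norm w"
        using \<open>c > 0\<close> by (simp add: field_simps)
    qed
  qed simp
  fix \<gamma> assume "abs_continuous_on_interval 0 1 \<gamma> \<and> \<gamma> ` {0..1} \<subseteq> U"
  then have ac: "abs_continuous_on_interval 0 1 \<gamma>" and \<gamma>U: "\<gamma> ` {0..1} \<subseteq> U"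
    by auto
  define \<delta> where "\<delta> t = vconcat (\<gamma> t) (G (\<gamma> t))" for t
  \<comment> \<open>This makes the lifted curve \<open>\<delta>\<close> absolutely continuous, so
    that the chain rule of \<open>F\<close> applies to it.\<close>
  have "(1 + L)-lipschitz_on U (\<lambda>x. vconcat x (G x))"
  proof (rule lipschitz_onI)
    fix x y assume "x \<in> U" "y \<in> U"
    then have "norm (G x - G y) \<le> L * norm (x - y)"
      using lipschitz_onD[OF lip] by (simp add: dist_norm)
    then show "dist (vconcat x (G x)) (vconcat y (G y)) \<le> (1 + L) * dist x y"
      using norm_vconcat_le[of "x - y" "G x - G y"]
      by (simp add: dist_norm vconcat_diff algebra_simps)
  qed (use lipschitz_on_nonneg[OF lip] in simp)
  then have "abs_continuous_on_interval 0 1 \<delta>"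
    unfolding \<delta>_def by (rule abs_continuous_on_interval_lipschitz_comp[OF ac \<gamma>U])
  then have "AE t in lebesgue_on {0..1}. \<exists>v.
         (\<delta> has_vector_derivative v) (at t within {0..1}) \<and>
         (\<forall>M\<in>JF (\<delta> t). ((\<lambda>s. F (\<delta> s)) has_vector_derivative M *v v) (at t within {0..1}))"
    using J by (simp add: conservative_jacobian_def)
  then show "AE t in lebesgue_on {0..1}. \<exists>v.
           (\<gamma> has_vector_derivative v) (at t within {0..1}) \<and>
           (\<forall>M\<in>JG (\<gamma> t).
              ((\<lambda>s. G (\<gamma> s)) has_vector_derivative M *v v) (at t within {0..1}))"
  proof (rule AE_mp, intro AE_I2 impI)
    fix t assume "t \<in> space (lebesgue_on {0..1::real})"
    then have t: "t \<in> {0..1}" and tU: "\<gamma> t \<in> U"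
      using \<gamma>U by auto
    assume "\<exists>v. (\<delta> has_vector_derivative v) (at t within {0..1}) \<and>
         (\<forall>M\<in>JF (\<delta> t). ((\<lambda>s. F (\<delta> s)) has_vector_derivative M *v v) (at t within {0..1}))"
    then obtain v w where \<delta>: "(\<delta> has_vector_derivative vconcat v w) (at t within {0..1})"
      and F\<delta>: "\<And>M. M \<in> JF (\<delta> t) \<Longrightarrow>
        ((\<lambda>s. F (\<delta> s)) has_vector_derivative M *v vconcat v w) (at t within {0..1})"
      by (metis vconcat_cases)
    \<comment> \<open>Thus \<open>v\<close> and \<open>w\<close> are the derivatives of
      \<open>\<gamma>\<close> and \<open>G \<circ> \<gamma>\<close>; it remains to see that every
      \<open>N\<close> maps \<open>v\<close> to \<open>w\<close>.\<close>
    note \<gamma>' = has_vector_derivative_vconcatD[OF \<delta>[unfolded \<delta>_def]]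
    have zero': "((\<lambda>s. F (\<delta> s)) has_vector_derivative 0) (at t within {0..1})"
      by (rule has_vector_derivative_transform[OF t _ has_vector_derivative_const[of 0]])
         (use \<gamma>U zero in \<open>simp add: \<delta>_def image_subset_iff\<close>)
    have "N *v v = w" if "N \<in> JG (\<gamma> t)" for N
    proof -
      obtain M where M: "M \<in> JF (\<delta> t)" "M *v vconcat v (N *v v) = 0"
        using JG[OF tU] \<open>N \<in> JG (\<gamma> t)\<close> unfolding \<delta>_def by blast
      \<comment> \<open>The chain rule holds for every element of \<open>JF (\<delta> t)\<close>, in
        particular for the \<open>M\<close> attached to \<open>N\<close>. So \<open>M\<close>
        annihilates both \<open>vconcat v (N *v v)\<close> and \<open>vconcat v w\<close>, and
        \<open>lower\<close> applied to their difference gives equality.\<close>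
      have "M *v vconcat v w = 0"
        using vector_derivative_unique_within_closed_interval[of 0 1 t "\<lambda>s. F (\<delta> s)"]
          F\<delta>[OF M(1)] zero' t by auto
      then have "M *v (vconcat v (N *v v) - vconcat v w) = 0"
        by (simp add: matrix_vector_mult_diff_distrib M(2))
      then have "M *v vconcat 0 (N *v v - w) = 0"
        by (simp add: vconcat_diff)
      then show ?thesis
        using lower[OF tU, of M "N *v v - w"] M(1) \<open>c > 0\<close> by (simp add: \<delta>_def mult_le_0_iff)
    qed
    then show "\<exists>v. (\<gamma> has_vector_derivative v) (at t within {0..1}) \<and>
           (\<forall>M\<in>JG (\<gamma> t).
              ((\<lambda>s. G (\<gamma> s)) has_vector_derivative M *v v) (at t within {0..1}))"
      using \<gamma>' by auto
  qed
qed (use assms in auto)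

section \<open>Uniform constants and assembly\<close>

text \<open>Over all \<open>M\<close> in \<open>\<J>\<close> and unit vectors \<open>v\<close>, a
  compact set of pairs, \<open>norm (M *v vconcat 0 v)\<close> attains its minimum. It is positive
  because each right block has trivial kernel, and homogeneity in \<open>v\<close> extends the bound
  to all vectors.\<close>

lemma invertible_blocks_uniform_lower_bound:
  fixes \<J> :: "(real^('n::finite + 'm::finite)^'m) set"
  assumes "compact \<J>" "\<J> \<noteq> {}"
    and inv: "\<And>(A :: real^'n^'m) (B :: real^'m^'m). mconcat A B \<in> \<J> \<Longrightarrow> invertible B"
  obtains c where "c > 0" "\<And>M (v::real^'m). M \<in> \<J> \<Longrightarrow> c * norm v \<le> norm (M *v vconcat 0 v)"
proof -
  define f where "f p = norm (fst p *v vconcat (0::real^'n) (snd p))"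
    for p :: "(real^('n + 'm)^'m) \<times> (real^'m)"
  obtain e :: "real^'m" where "norm e = 1"
    using vector_choose_size[of 1] by auto
  then have "\<J> \<times> sphere 0 1 \<noteq> ({} :: ((real^('n + 'm)^'m) \<times> (real^'m)) set)"
    using assms(2) by auto
  moreover have "continuous_on (\<J> \<times> sphere 0 1) f"
    unfolding f_def
    by (intro continuous_on_norm continuous_on_matrix_vector_mult continuous_on_vconcat
        continuous_intros)
  ultimately obtain p where p: "p \<in> \<J> \<times> sphere 0 1" "\<And>q. q \<in> \<J> \<times> sphere 0 1 \<Longrightarrow> f p \<le> f q"
    using continuous_attains_inf[OF compact_Times[OF assms(1) compact_sphere]] by metis
  obtain A :: "real^'n^'m" and B where AB: "fst p = mconcat A B"
    by (rule mconcat_cases)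
  have "invertible B"
    using p(1) AB inv by (metis mem_Times_iff)
  moreover have "norm (snd p) = 1"
    using p(1) by (auto simp: mem_Times_iff)
  ultimately have "B *v snd p \<noteq> 0"
    unfolding invertible_iff_ker by force
  then have "f p > 0"
    by (simp add: f_def AB mconcat_mult_vconcat)
  moreover have "f p * norm v \<le> norm (M *v vconcat 0 v)" if M: "M \<in> \<J>" for M and v :: "real^'m"
  proof (cases "v = 0")
    case False
    have "vconcat 0 v = norm v *\<^sub>R vconcat (0::real^'n) (v /\<^sub>R norm v)"
      using False by (auto simp: vec_eq_iff vconcat_def split: sum.split)
    then have "norm (M *v vconcat 0 v) = norm v * f (M, v /\<^sub>R norm v)"
      by (simp add: f_def matrix_vector_mult_scaleR)
    moreover have "f p \<le> f (M, v /\<^sub>R norm v)"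
      using M False by (intro p(2)) auto
    ultimately show ?thesis
      by (simp add: mult.commute mult_left_mono)
  qed simp
  ultimately show ?thesis
    using that by blast
qed

theorem corollary1:
  fixes F :: "real^('n::finite + 'm::finite) \<Rightarrow> real^'m"
    and JF :: "real^('n + 'm) \<Rightarrow> (real^('n + 'm)^'m) set"
    and xh :: "real^'n" and yh :: "real^'m"
  assumes "path_differentiable_on UNIV F"
    and "conservative_jacobian UNIV F JF"
    and "F (vconcat xh yh) = 0"
    and "convex (JF (vconcat xh yh))"
    and "\<And>(A :: real^'n^'m) (B :: real^'m^'m).
           mconcat A B \<in> JF (vconcat xh yh) \<Longrightarrow> invertible B"
  shows "\<exists>(U :: (real^'n) set) (V :: (real^'m) set) (G :: real^'n \<Rightarrow> real^'m).
           open U \<and> open V \<and> xh \<in> U \<and> yh \<in> V \<and> G ` U \<subseteq> V \<and>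
           path_differentiable_on U G \<and>
           (\<forall>x\<in>U. F (vconcat x (G x)) = 0) \<and>
           (\<forall>x\<in>U. \<forall>(A :: real^'n^'m) (B :: real^'m^'m).
              mconcat A B \<in> JF (vconcat x (G x)) \<longrightarrow> invertible B) \<and>
           conservative_jacobian U G
             (\<lambda>x. {- (matrix_inv B ** A) | (A :: real^'n^'m) (B :: real^'m^'m).
                     mconcat A B \<in> JF (vconcat x (G x))})"
proof -
  note J = assms(2)
  define zh where "zh = vconcat xh yh"
  have JF_nonempty: "JF z \<noteq> {}" for z
    using J by (simp add: conservative_jacobian_def)
  obtain u L where u: "u > 0" "L-lipschitz_on (ball zh u) F"
    using J unfolding conservative_jacobian_def locally_lipschitz_on_def Int_UNIV_right
    by (meson UNIV_I)
  have comp: "compact (JF zh)"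
    by (rule conservative_jacobian_compact_values[OF J]) simp
  then obtain b where b: "\<And>M. M \<in> JF zh \<Longrightarrow> norm M \<le> b"
    using compact_imp_bounded bounded_iff by metis
  obtain c where c: "c > 0"
    "\<And>M (v::real^'m). M \<in> JF zh \<Longrightarrow> c * norm v \<le> norm (M *v vconcat 0 v)"
    by (rule invertible_blocks_uniform_lower_bound[OF comp JF_nonempty])
       (use assms(5) in \<open>auto simp: zh_def\<close>)
  have "c / 2 > 0" using c(1) by simp
  then obtain d where d: "d > 0" "\<And>z M. z \<in> ball zh d \<Longrightarrow> M \<in> JF z \<Longrightarrow> \<exists>m\<in>JF zh. dist M m < c / 2"
    using conservative_jacobian_upper_semicontinuous[OF J UNIV_I[of zh]] by fastforce
  \<comment> \<open>The sum of a compact convex set and a closed ball is again compact and convex.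
    The radius \<open>c / 2\<close> costs half of the lower bound and leaves \<open>c / 2\<close>
    for all of \<open>K\<close>.\<close>
  define K where "K = (\<Union>m\<in>JF zh. \<Union>E\<in>cball 0 (c / 2). {m + E})"
  have K: "compact K" "convex K"
    unfolding K_def using comp assms(4)
    by (auto intro!: compact_sums' convex_sums simp: zh_def)
  \<comment> \<open>The constant \<open>\<bar>b\<bar> + c\<close> exceeds \<open>b + c / 2\<close>
    and is plainly positive, as the existence lemma asks of \<open>C\<close>.\<close>
  have upper: "norm M \<le> \<bar>b\<bar> + c" and lower: "c / 2 * norm v \<le> norm (M *v vconcat 0 v)"
    if MK: "M \<in> K" for M and v :: "real^'m"
  proof -
    obtain m E where mE: "m \<in> JF zh" "norm E \<le> c / 2" "M = m + E"
      using MK by (auto simp: K_def)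
    show "norm M \<le> \<bar>b\<bar> + c"
      unfolding mE(3) using norm_triangle_ineq[of m E] b[OF mE(1)] mE(2) c(1) by linarith
    have "norm (E *v vconcat (0::real^'n) v) \<le> norm E * norm v"
      using norm_matrix_vector_mult_le[of E "vconcat (0::real^'n) v"] by simp
    also have "\<dots> \<le> c / 2 * norm v"
      using mE(2) by (rule mult_right_mono) simp
    finally have "norm (E *v vconcat (0::real^'n) v) \<le> c / 2 * norm v" .
    moreover have "norm (m *v vconcat 0 v) \<le> norm (M *v vconcat 0 v) + norm (E *v vconcat 0 v)"
      using norm_triangle_ineq4[of "M *v vconcat 0 v" "E *v vconcat 0 v"]
      by (simp add: mE(3) matrix_vector_mult_add_rdistrib)
    ultimately show "c / 2 * norm v \<le> norm (M *v vconcat 0 v)"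
      using c(2)[OF mE(1), of v] by linarith
  qed
  \<comment> \<open>Within \<open>u\<close> the function is Lipschitz, as the mean value formula
    asks; within \<open>d\<close> upper semicontinuity keeps \<open>JF\<close> inside
    \<open>K\<close>.\<close>
  define r where "r = min u d"
  have JK: "JF z \<subseteq> K" if "z \<in> ball zh r" for z
  proof
    fix M assume "M \<in> JF z"
    then obtain m where "m \<in> JF zh" "dist M m < c / 2"
      using d(2)[of z M] \<open>z \<in> ball zh r\<close> by (auto simp: r_def)
    then have "M - m \<in> cball 0 (c / 2)" "M \<in> {m + (M - m)}"
      by (simp_all add: dist_norm norm_minus_commute)
    with \<open>m \<in> JF zh\<close> show "M \<in> K"
      unfolding K_def by blast
  qed
  have mv: "\<exists>M\<in>K. F z' - F z = M *v (z' - z)" if "z \<in> ball zh r" "z' \<in> ball zh r" for z z'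
  proof -
    have seg: "closed_segment z z' \<subseteq> ball zh r"
      using that by (intro closed_segment_subset convex_ball)
    moreover have "ball zh r \<subseteq> ball zh u"
      by (auto simp: r_def)
    ultimately show ?thesis
      by (intro conservative_jacobian_mean_value[OF J _ lipschitz_on_subset[OF u(2)] K] JK) auto
  qed
  have cont: "continuous_on (ball zh r) F"
    by (rule continuous_on_subset[OF lipschitz_on_continuous_on[OF u(2)]]) (auto simp: r_def)
  have "r > 0" "\<bar>b\<bar> + c > 0"
    using u(1) d(1) c(1) by (auto simp: r_def)
  then obtain s \<rho> G where s: "s > 0" and \<rho>: "\<rho> > 0" and GV: "G ` ball xh s \<subseteq> ball yh \<rho>"
    and G_lip: "((\<bar>b\<bar> + c) / (c / 2))-lipschitz_on (ball xh s) G"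
    and G_zero: "\<And>x. x \<in> ball xh s \<Longrightarrow> F (vconcat x (G x)) = 0"
    and G_mem: "\<And>x. x \<in> ball xh s \<Longrightarrow> vconcat x (G x) \<in> ball zh r"
    using lipschitz_implicit_function[OF _ \<open>c / 2 > 0\<close> _ assms(3) cont[unfolded zh_def]
        mv[unfolded zh_def] upper lower]
    unfolding zh_def by metis
  let ?U = "ball xh s"
  let ?JG = "\<lambda>x. {- (matrix_inv B ** A) | (A :: real^'n^'m) (B :: real^'m^'m).
                     mconcat A B \<in> JF (vconcat x (G x))}"
  have in_K: "M \<in> K" if "x \<in> ?U" "M \<in> JF (vconcat x (G x))" for x M
    using JK[OF G_mem[OF that(1)]] that(2) by blast
  \<comment> \<open>Invertibility persists because the graph of \<open>G\<close> stays where
    \<open>JF\<close> lies in \<open>K\<close>, and there \<open>lower\<close> excludes nonzero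
    kernel vectors of the right block.\<close>
  have inv: "invertible B" if "x \<in> ?U" "mconcat A B \<in> JF (vconcat x (G x))"
    for x and A :: "real^'n^'m" and B :: "real^'m^'m"
    unfolding invertible_iff_ker
  proof (intro allI impI)
    fix v assume "B *v v = 0"
    then have "mconcat A B *v vconcat 0 v = 0"
      by (simp add: mconcat_mult_vconcat)
    then show "v = 0"
      using lower[OF in_K[OF that], of v] c(1) by (simp add: mult_le_0_iff)
  qed
  \<comment> \<open>As the right blocks are invertible along the graph, \<open>?JG\<close> takes the
    inverse-free form that \<open>conservative_jacobian_implicit\<close> expects.\<close>
  have JG_iff: "N \<in> ?JG x \<longleftrightarrow> (\<exists>M\<in>JF (vconcat x (G x)). \<forall>w. M *v vconcat w (N *v w) = 0)"
    if x: "x \<in> ?U" for x N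
  proof
    assume "N \<in> ?JG x"
    then show "\<exists>M\<in>JF (vconcat x (G x)). \<forall>w. M *v vconcat w (N *v w) = 0"
      using eq_neg_matrix_inv_mult_iff inv[OF x] by blast
  next
    assume "\<exists>M\<in>JF (vconcat x (G x)). \<forall>w. M *v vconcat w (N *v w) = 0"
    then obtain A :: "real^'n^'m" and B where "mconcat A B \<in> JF (vconcat x (G x))"
        "\<forall>w. mconcat A B *v vconcat w (N *v w) = 0"
      by (metis mconcat_cases)
    then show "N \<in> ?JG x"
      using eq_neg_matrix_inv_mult_iff inv[OF x] by blast
  qed
  have JG_nonempty: "?JG x \<noteq> {}" for x
  proof -
    obtain A :: "real^'n^'m" and B where "mconcat A B \<in> JF (vconcat x (G x))"
      using JF_nonempty by (metis ex_in_conv mconcat_cases)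
    then show ?thesis by blast
  qed
  have cons: "conservative_jacobian ?U G ?JG"
    by (rule conservative_jacobian_implicit[OF J open_ball G_lip G_zero \<open>c / 2 > 0\<close>
          upper[OF in_K] lower[OF in_K] JG_nonempty JG_iff])
  then have "locally_lipschitz_on ?U G"
    by (simp add: conservative_jacobian_def)
  with cons have "path_differentiable_on ?U G"
    unfolding path_differentiable_on_def by blast
  with cons s \<rho> GV G_zero inv show ?thesis
    by (intro exI[of _ ?U] exI[of _ "ball yh \<rho>"] exI[of _ G] conjI) auto
qed

end
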